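(* Let $\rho$ be a pure state (rank-one orthogonal projector) on $\mathbb{C}^2\otimes\mathbb{C}^2$ that is entangled. Let $\rho^{T_2}=(\mathbf 1\otimes T)\rho$ be its partial transpose on the second factor, and let $\rho'=(\mathbf 1\otimes\sigma_y)\,\rho\,(\mathbf 1\otimes\sigma_y)$ be the rank-one projector obtained from $\rho$ by a rotation by $\pi$ about the $y$-axis on the second system. Then $\mathrm{Tr}(\rho^{T_2}\rho')<0$; in particular $\rho^{T_2}$ is not a positive semidefinite operator.
   Context: $\sigma_y=\begin{pmatrix}0&-i\\ i&0\end{pmatrix}$ is the Pauli matrix in the standard basis of $\mathbb{C}^2$. The map $T$ is matrix transposition in the standard basis of $\mathbb{C}^2$, and $\mathbf 1\otimes T$ is its extension to operators on $\mathbb{C}^2\otimes\mathbb{C}^2$ acting on the second factor: $(\mathbf 1\otimes T)(X\otimes Y)=X\otimes Y^{\mathrm T}$, extended linearly. A pure state $|\Psi\rangle\langle\Psi|$ is entangled if $|\Psi\rangle$ is not of the form $|\phi\rangle\otimes|\psi\rangle$. *)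

theory Defs
  imports "HOL-Analysis.Analysis" "HOL-Library.Complex_Order"
begin

text \<open>The space \<open>\<complex>\<^sup>m \<otimes> \<complex>\<^sup>n\<close> is modelled by vectors indexed by pairs, in the product basis.\<close>

definition tensor_vec :: "complex^'m \<Rightarrow> complex^'n \<Rightarrow> complex^('m::finite \<times> 'n::finite)"  (infixl \<open>\<otimes>\<^sub>v\<close> 75)
  where "x \<otimes>\<^sub>v y = (\<chi> p. x $ fst p * y $ snd p)"

definition tensor_mat :: "complex^'m^'m \<Rightarrow> complex^'n^'n \<Rightarrow> complex^('m::finite \<times> 'n::finite)^('m::finite \<times> 'n::finite)"  (infixl \<open>\<otimes>\<^sub>m\<close> 75)
  where "X \<otimes>\<^sub>m Y = (\<chi> p q. X $ fst p $ fst q * Y $ snd p $ snd q)"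

definition cadjoint :: "complex^'n^'m \<Rightarrow> complex^'m^'n"
  where "cadjoint A = (\<chi> i j. cnj (A $ j $ i))"

definition cinner_vec :: "complex^'n \<Rightarrow> complex^'n \<Rightarrow> complex"
  where "cinner_vec x y = (\<Sum>i\<in>UNIV. cnj (x $ i) * y $ i)"

definition ketbra :: "complex^'n \<Rightarrow> complex^'n^'n"
  where "ketbra x = (\<chi> i j. x $ i * cnj (x $ j))"

text \<open>The order on \<^typ>\<open>complex\<close> is that of \<^theory>\<open>HOL-Library.Complex_Order\<close>:
  \<open>0 \<le> z\<close> means that \<open>z\<close> is real and nonnegative, and \<open>z < 0\<close> that it is real and negative.\<close>

definition pos_semidef :: "complex^'n^'n \<Rightarrow> bool"
  where "pos_semidef A \<longleftrightarrow> (\<forall>x. 0 \<le> cinner_vec x (A *v x))"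

definition orthogonal_projector :: "complex^'n^'n \<Rightarrow> bool"
  where "orthogonal_projector P \<longleftrightarrow> cadjoint P = P \<and> P ** P = P"

definition pure_state :: "complex^'n^'n \<Rightarrow> bool"
  where "pure_state \<rho> \<longleftrightarrow> orthogonal_projector \<rho> \<and> rank \<rho> = 1"

definition product_vec :: "complex^('m::finite \<times> 'n::finite) \<Rightarrow> bool"
  where "product_vec \<Psi> \<longleftrightarrow> (\<exists>\<phi> \<psi>. \<Psi> = \<phi> \<otimes>\<^sub>v \<psi>)"

text \<open>A pure state determines its vector up to a phase (see \<open>entangled_ketbra\<close> and
  \<open>pure_state_imp_ketbra\<close> below), so quantifying over all such vectors is harmless.\<close>

definition entangled :: "complex^('m::finite \<times> 'n::finite)^('m::finite \<times> 'n::finite) \<Rightarrow> bool"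
  where "entangled \<rho> \<longleftrightarrow> pure_state \<rho> \<and> (\<forall>\<Psi>. \<rho> = ketbra \<Psi> \<longrightarrow> \<not> product_vec \<Psi>)"

text \<open>The extension \<open>1 \<otimes> F\<close> of a linear map \<open>F\<close> on matrices applies \<open>F\<close> to each block
  \<open>(X\<^sub>(\<^sub>i\<^sub>,\<^sub>k\<^sub>)\<^sub>,\<^sub>(\<^sub>j\<^sub>,\<^sub>l\<^sub>))\<^sub>k\<^sub>l\<close> with \<open>i\<close>, \<open>j\<close> fixed;
  \<open>partial_transpose_unique\<close> below confirms that this is the linear extension of
  \<open>X \<otimes> Y \<mapsto> X \<otimes> Y\<^sup>T\<close>.\<close>

definition extend_snd :: "(complex^'n^'n \<Rightarrow> complex^'n^'n) \<Rightarrow>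
    complex^('m::finite \<times> 'n::finite)^('m::finite \<times> 'n::finite) \<Rightarrow> complex^('m::finite \<times> 'n::finite)^('m::finite \<times> 'n::finite)"
  where "extend_snd F X =
    (\<chi> p q. F (\<chi> k l. X $ (fst p, k) $ (fst q, l)) $ snd p $ snd q)"

definition partial_transpose :: "complex^('m::finite \<times> 'n::finite)^('m::finite \<times> 'n::finite) \<Rightarrow> complex^('m::finite \<times> 'n::finite)^('m::finite \<times> 'n::finite)"
  where "partial_transpose = extend_snd transpose"

definition sigma_y :: "complex^2^2"
  where "sigma_y = vector [vector [0, - \<i>], vector [\<i>, 0]]"

lemma partial_transpose_tensor: "partial_transpose (X \<otimes>\<^sub>m Y) = X \<otimes>\<^sub>m transpose Y"
  by (simp add: partial_transpose_def extend_snd_def tensor_mat_def transpose_def vec_eq_iff)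

lemma partial_transpose_add: "partial_transpose (A + B) = partial_transpose A + partial_transpose B"
  by (simp add: partial_transpose_def extend_snd_def transpose_def vec_eq_iff)

lemma partial_transpose_scale:
  "partial_transpose (\<chi> p q. c * A $ p $ q) = (\<chi> p q. c * partial_transpose A $ p $ q)"
  by (simp add: partial_transpose_def extend_snd_def transpose_def vec_eq_iff)

lemma tensor_mat_decomp:
  fixes A :: "complex^('m::finite \<times> 'n::finite)^('m::finite \<times> 'n::finite)"
  shows "A = (\<Sum>(p, q)\<in>UNIV.
    (\<chi> i j. if i = fst p \<and> j = fst q then A $ p $ q else 0) \<otimes>\<^sub>m
    (\<chi> k l. if k = snd p \<and> l = snd q then 1 else 0))"
proof -
  have "(\<Sum>(p, q)\<in>UNIV.
    (\<chi> i j. if i = fst p \<and> j = fst q then A $ p $ q else 0) \<otimes>\<^sub>m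
    (\<chi> k l. if k = snd p \<and> l = snd q then 1 else 0)) $ r $ s = A $ r $ s" for r s :: "'m \<times> 'n"
  proof -
    have "(\<Sum>(p, q)\<in>UNIV.
        (\<chi> i j. if i = fst p \<and> j = fst q then A $ p $ q else 0) \<otimes>\<^sub>m
        (\<chi> k l. if k = snd p \<and> l = snd q then 1 else 0)) $ r $ s
      = (\<Sum>z\<in>UNIV. if z = (r, s) then A $ r $ s else (0 :: complex))"
      unfolding sum_component
      by (rule sum.cong) (auto simp: tensor_mat_def prod_eq_iff split: prod.splits)
    then show ?thesis by simp
  qed
  then show ?thesis by (simp add: vec_eq_iff)
qed

lemma partial_transpose_unique:
  fixes L :: "complex^('m::finite \<times> 'n::finite)^('m::finite \<times> 'n::finite) \<Rightarrow> complex^('m::finite \<times> 'n::finite)^('m::finite \<times> 'n::finite)"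
  assumes add: "\<And>A B. L (A + B) = L A + L B"
    and tensor: "\<And>X Y. L (X \<otimes>\<^sub>m Y) = X \<otimes>\<^sub>m transpose Y"
  shows "L = partial_transpose"
proof
  fix A
  have L0: "L 0 = 0" using add[of 0 0] by simp
  have P0: "partial_transpose (0 :: complex^('m::finite \<times> 'n::finite)^('m::finite \<times> 'n::finite)) = 0"
    using partial_transpose_add[of 0 "0 :: complex^('m::finite \<times> 'n::finite)^('m::finite \<times> 'n::finite)"] by simp
  have L: "L (sum f S) = (\<Sum>x\<in>S. L (f x))" if "finite S"
    for f :: "('m::finite \<times> 'n::finite) \<times> ('m::finite \<times> 'n::finite) \<Rightarrow> complex^('m::finite \<times> 'n::finite)^('m::finite \<times> 'n::finite)" and S
    using that by induction (simp_all add: L0 add)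
  have P: "partial_transpose (sum f S) = (\<Sum>x\<in>S. partial_transpose (f x))" if "finite S"
    for f :: "('m::finite \<times> 'n::finite) \<times> ('m::finite \<times> 'n::finite) \<Rightarrow> complex^('m::finite \<times> 'n::finite)^('m::finite \<times> 'n::finite)" and S
    using that by induction (simp_all add: P0 partial_transpose_add)
  show "L A = partial_transpose A"
    by (subst (1 2) tensor_mat_decomp)
      (simp add: L P tensor partial_transpose_tensor case_prod_unfold)
qed

lemma ketbra_eq_imp_product_vec:
  assumes eq: "ketbra \<Psi> = ketbra \<Phi>" and prod: "product_vec \<Phi>"
  shows "product_vec \<Psi>"
proof -
  have e: "\<Psi> $ i * cnj (\<Psi> $ j) = \<Phi> $ i * cnj (\<Phi> $ j)" for i j
    using arg_cong[OF eq, of "\<lambda>M. M $ i $ j"] by (simp add: ketbra_def)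
  obtain \<phi> \<psi> where p: "\<Phi> = \<phi> \<otimes>\<^sub>v \<psi>" using prod by (auto simp: product_vec_def)
  show ?thesis
  proof (cases "\<Psi> = 0")
    case True
    then have "\<Psi> = 0 \<otimes>\<^sub>v 0" by (simp add: tensor_vec_def vec_eq_iff)
    then show ?thesis by (auto simp: product_vec_def)
  next
    case False
    then obtain j where j: "\<Psi> $ j \<noteq> 0" by (auto simp: vec_eq_iff)
    define c where "c = cnj (\<Phi> $ j) / cnj (\<Psi> $ j)"
    have "\<Psi> $ i = c * \<Phi> $ i" for i
      using e[of i j] j by (simp add: c_def field_simps)
    then have "\<Psi> = (\<chi> i. c * \<phi> $ i) \<otimes>\<^sub>v \<psi>"
      by (simp add: p tensor_vec_def vec_eq_iff)
    then show ?thesis by (auto simp: product_vec_def)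
  qed
qed

lemma entangled_ketbra:
  assumes "pure_state (ketbra \<Psi>)"
  shows "entangled (ketbra \<Psi>) \<longleftrightarrow> \<not> product_vec \<Psi>"
  using assms ketbra_eq_imp_product_vec unfolding entangled_def by metis

lemma pure_state_imp_ketbra:
  assumes "pure_state \<rho>"
  shows "\<exists>\<Psi>. cinner_vec \<Psi> \<Psi> = 1 \<and> \<rho> = ketbra \<Psi>"
proof -
  have herm: "cnj (\<rho> $ j $ i) = \<rho> $ i $ j" for i j
    using assms by (simp add: pure_state_def orthogonal_projector_def cadjoint_def vec_eq_iff)
  have idem: "\<rho> ** \<rho> = \<rho>" and dim: "vec.dim (rows \<rho>) = 1"
    using assms by (simp_all add: pure_state_def orthogonal_projector_def row_rank_def_gen)
  obtain B where B: "rows \<rho> \<subseteq> vec.span B" "card B = 1"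
    using vec.basis_exists[of "rows \<rho>"] dim by metis
  then obtain b where b: "B = {b}" by (auto simp: card_1_singleton_iff)
  have "\<exists>c. \<rho> $ i = c *s b" for i
  proof -
    have "row i \<rho> \<in> vec.span {b}" using B b by (auto simp: rows_def)
    then show ?thesis by (auto simp: vec.span_singleton row_def)
  qed
  then obtain c where "\<And>i. \<rho> $ i = c i *s b" by metis
  then have c: "\<rho> $ i $ j = c i * b $ j" for i j by simp
  have "\<rho> \<noteq> 0"
  proof
    assume "\<rho> = 0"
    then have "rows \<rho> \<subseteq> {0}" by (auto simp: rows_def row_def vec_eq_iff)
    then show False using dim vec.dim_eq_0 by (metis zero_neq_one)
  qed
  then obtain i0 j0 where ne: "c i0 \<noteq> 0" "b $ j0 \<noteq> 0"
    by (auto simp: vec_eq_iff c)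
  define k where "k = cnj (c j0) / b $ j0"
  have ck: "c i = k * cnj (b $ i)" for i
    using herm[of j0 i] ne by (simp add: c k_def field_simps)
  have "(\<Sum>l\<in>UNIV. \<rho> $ i0 $ l * \<rho> $ l $ j0) = \<rho> $ i0 $ j0"
    using arg_cong[OF idem, of "\<lambda>M. M $ i0 $ j0"] by (simp add: matrix_matrix_mult_def)
  moreover have "(\<Sum>l\<in>UNIV. \<rho> $ i0 $ l * \<rho> $ l $ j0) =
      c i0 * b $ j0 * (k * (\<Sum>l\<in>UNIV. cnj (b $ l) * b $ l))"
    by (simp add: c ck[of l for l] sum_distrib_left mult_ac)
  ultimately have "k * (\<Sum>l\<in>UNIV. cnj (b $ l) * b $ l) = 1"
    using ne by (simp add: c)
  moreover define r where "r = (\<Sum>l\<in>UNIV. (cmod (b $ l))\<^sup>2)"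
  moreover have "(\<Sum>l\<in>UNIV. cnj (b $ l) * b $ l) = of_real r"
    unfolding r_def of_real_sum
    by (intro sum.cong refl) (metis complex_norm_square mult.commute)
  ultimately have kr: "k * of_real r = 1" by simp
  have "r \<ge> 0" unfolding r_def by (simp add: sum_nonneg)
  moreover have "r \<noteq> 0" using kr by auto
  ultimately have r: "r > 0" by simp
  have k: "k = of_real (1 / r)" using kr r by (simp add: field_simps)
  have s: "complex_of_real (sqrt (1 / r)) * of_real (sqrt (1 / r)) = k"
    using r k by (metis less_eq_real_def of_real_mult real_sqrt_mult_self abs_of_nonneg zero_le_divide_1_iff)
  define \<Psi> where "\<Psi> = (\<chi> i. of_real (sqrt (1 / r)) * cnj (b $ i))"
  have eq: "\<rho> = ketbra \<Psi>"
  proof -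
    have "\<Psi> $ i * cnj (\<Psi> $ j) = k * cnj (b $ i) * b $ j" for i j
      unfolding s[symmetric] by (simp add: \<Psi>_def)
    then show ?thesis by (simp add: ketbra_def vec_eq_iff c ck)
  qed
  have "cinner_vec \<Psi> \<Psi> = k * (\<Sum>l\<in>UNIV. cnj (b $ l) * b $ l)"
    unfolding s[symmetric] by (simp add: cinner_vec_def \<Psi>_def sum_distrib_left mult_ac)
  then show ?thesis using eq \<open>k * (\<Sum>l\<in>UNIV. cnj (b $ l) * b $ l) = 1\<close> by auto
qed

end

theory Submission
  imports Defs
begin

text \<open>Write \<open>\<rho> = |\<Psi>\<rangle>\<langle>\<Psi>|\<close>, let \<open>M\<close> be the \<open>2 \<times> 2\<close> matrix of coefficients of \<open>\<Psi>\<close>, and put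
  \<open>\<Phi> = (1 \<otimes> \<sigma>\<^sub>y) \<Psi>\<close>. Then \<open>\<rho>' = |\<Phi>\<rangle>\<langle>\<Phi>|\<close>, so the trace equals the expectation value of
  \<open>\<rho>\<^sup>T\<close> at \<open>\<Phi>\<close>. Expanding it in the Gram matrix of the columns of \<open>M\<close> gives
  \<open>- 2 \<bar>det M\<bar>\<^sup>2\<close>, and \<open>det M = 0\<close> exactly when \<open>\<Psi>\<close> is a product vector.\<close>

lemma sum_UNIV_2x2: "(\<Sum>p\<in>(UNIV :: (2 \<times> 2) set). f p) = f (1,1) + f (1,2) + (f (2,1) + f (2,2))"
  unfolding UNIV_Times_UNIV[symmetric] sum.cartesian_product' sum_2 ..

text \<open>This turns the trace into an expectation value, so one negative number settles both
  claims of the theorem.\<close>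

lemma trace_mult_ketbra: "trace (A ** ketbra x) = cinner_vec x (A *v x)"
  by (simp add: trace_def matrix_matrix_mult_def ketbra_def cinner_vec_def
      matrix_vector_mult_def sum_distrib_left mult_ac)

lemma conjugate_ketbra: "X ** ketbra x ** cadjoint X = ketbra (X *v x)"
  by (simp add: vec_eq_iff matrix_matrix_mult_def ketbra_def cadjoint_def
      matrix_vector_mult_def sum_product sum_distrib_left sum_distrib_right mult_ac)

lemma cadjoint_tensor_mat: "cadjoint (X \<otimes>\<^sub>m Y) = cadjoint X \<otimes>\<^sub>m cadjoint Y"
  by (simp add: vec_eq_iff cadjoint_def tensor_mat_def)

lemma cadjoint_mat_1: "cadjoint (mat 1) = mat 1"
  by (simp add: vec_eq_iff cadjoint_def mat_def)

lemma cadjoint_sigma_y: "cadjoint sigma_y = sigma_y"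
  by (simp add: vec_eq_iff cadjoint_def sigma_y_def forall_2)

text \<open>A \<open>2 \<times> 2\<close> coefficient matrix with determinant zero has rank at most
  one, hence is an outer product.\<close>

lemma product_vec_if_det_eq_0:
  fixes \<Psi> :: "complex^(2 \<times> 2)"
  assumes "\<Psi> $ (1,1) * \<Psi> $ (2,2) = \<Psi> $ (1,2) * \<Psi> $ (2,1)"
  shows "product_vec \<Psi>"
proof -
  have product: "product_vec \<Psi>"
    if "\<Psi> $ (1,1) = x * u" "\<Psi> $ (1,2) = x * v" "\<Psi> $ (2,1) = y * u" "\<Psi> $ (2,2) = y * v"
    for x y u v
  proof -
    have "\<Psi> = vector [x, y] \<otimes>\<^sub>v vector [u, v]"
      using that by (simp add: vec_eq_iff tensor_vec_def split_paired_all forall_2)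
    then show ?thesis by (auto simp: product_vec_def)
  qed
  \<comment> \<open>A nonzero corner entry is a pivot: row two is a multiple of row one. Otherwise
    the rest of the first row or of the first column vanishes.\<close>
  consider "\<Psi> $ (1,1) \<noteq> 0" | "\<Psi> $ (1,1) = 0" "\<Psi> $ (1,2) = 0" | "\<Psi> $ (1,1) = 0" "\<Psi> $ (2,1) = 0"
    using assms by (metis mult_eq_0_iff)
  then show ?thesis
  proof cases
    case 1
    then show ?thesis
      using assms
      by (intro product[of 1 "\<Psi> $ (1,1)" "\<Psi> $ (1,2)" "\<Psi> $ (2,1) / \<Psi> $ (1,1)"])
        (simp_all add: field_simps)
  next
    case 2
    then show ?thesis by (intro product[of 0 "\<Psi> $ (2,1)" "\<Psi> $ (2,2)" 1]) simp_all
  next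
    case 3
    then show ?thesis by (intro product[of "\<Psi> $ (1,2)" 0 1 "\<Psi> $ (2,2)"]) simp_all
  qed
qed

lemma partial_transpose_expectation_flipped:
  fixes \<Psi> :: "complex^(2 \<times> 2)"
  defines "\<Phi> \<equiv> (mat 1 \<otimes>\<^sub>m sigma_y) *v \<Psi>"
    and "D \<equiv> \<Psi> $ (1,1) * \<Psi> $ (2,2) - \<Psi> $ (1,2) * \<Psi> $ (2,1)"
  shows "cinner_vec \<Phi> (partial_transpose (ketbra \<Psi>) *v \<Phi>) = - 2 * of_real ((cmod D)\<^sup>2)"
proof -
  have \<Phi>: "\<Phi> $ (i,1) = - \<i> * \<Psi> $ (i,2)" "\<Phi> $ (i,2) = \<i> * \<Psi> $ (i,1)" for i
    using exhaust_2[of i]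
    by (auto simp: \<Phi>_def matrix_vector_mult_def tensor_mat_def sum_UNIV_2x2 mat_def sigma_y_def)
  have PT: "partial_transpose (ketbra \<Psi>) $ (i,k) $ (j,l) = \<Psi> $ (i,l) * cnj (\<Psi> $ (j,k))" for i j k l
    by (simp add: partial_transpose_def extend_snd_def transpose_def ketbra_def)
  \<comment> \<open>With \<open>G\<close> the Gram matrix of the columns, the two diagonal pairs of
    second indices give \<open>G12 * G21\<close> each and the two mixed ones
    \<open>- G11 * G22\<close> each, in total \<open>- 2 * det G\<close>.\<close>
  have "cinner_vec \<Phi> (partial_transpose (ketbra \<Psi>) *v \<Phi>) = - 2 * (D * cnj D)"
    by (simp add: cinner_vec_def matrix_vector_mult_def sum_UNIV_2x2 \<Phi> PT D_def algebra_simps)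
  then show ?thesis by (simp only: complex_norm_square)
qed

theorem mainTheorem3:
  fixes \<rho> :: "complex^(2 \<times> 2)^(2 \<times> 2)"
  assumes "pure_state \<rho>" and "entangled \<rho>"
  shows "let \<rho>\<^sub>T = partial_transpose \<rho>;
             \<rho>' = (mat 1 \<otimes>\<^sub>m sigma_y) ** \<rho> ** (mat 1 \<otimes>\<^sub>m sigma_y)
         in trace (\<rho>\<^sub>T ** \<rho>') < 0 \<and> \<not> pos_semidef \<rho>\<^sub>T"
proof -
  obtain \<Psi> where \<rho>: "\<rho> = ketbra \<Psi>"
    using pure_state_imp_ketbra[OF assms(1)] by blast
  define \<Phi> where "\<Phi> = (mat 1 \<otimes>\<^sub>m sigma_y) *v \<Psi>"
  define D where "D = \<Psi> $ (1,1) * \<Psi> $ (2,2) - \<Psi> $ (1,2) * \<Psi> $ (2,1)"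
  have "\<not> product_vec \<Psi>"
    using assms(2) \<rho> by (simp add: entangled_def)
  then have "D \<noteq> 0"
    using product_vec_if_det_eq_0[of \<Psi>] by (auto simp: D_def)
  then have neg: "cinner_vec \<Phi> (partial_transpose \<rho> *v \<Phi>) < 0"
    unfolding \<rho> \<Phi>_def partial_transpose_expectation_flipped D_def[symmetric]
    by (simp add: less_complex_def)
  \<comment> \<open>Since \<open>sigma_y\<close> is Hermitian, the right factor is the adjoint of
    the left one.\<close>
  have "(mat 1 \<otimes>\<^sub>m sigma_y) ** \<rho> ** (mat 1 \<otimes>\<^sub>m sigma_y) = ketbra \<Phi>"
    using conjugate_ketbra[of "mat 1 \<otimes>\<^sub>m sigma_y" \<Psi>]
    by (simp add: \<rho> \<Phi>_def cadjoint_tensor_mat cadjoint_mat_1 cadjoint_sigma_y)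
  \<comment> \<open>The vector \<open>\<Phi>\<close> itself witnesses the failure of
    positivity.\<close>
  moreover have "\<not> pos_semidef (partial_transpose \<rho>)"
    using neg by (auto simp: pos_semidef_def dest: order.strict_trans1)
  ultimately show ?thesis
    using neg by (simp add: Let_def trace_mult_ketbra)
qed

end
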